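(* Let $P$ be a set of $n\ge e^2$ elements, let $k\ge 1$ be a fixed integer, and let $\Pi$ be a property of $P$. Let $\langle p_1,\dots,p_n\rangle$ be a uniformly random permutation of $P$. For each $i$, let $P_i=\{p_1,\dots,p_i\}$ and let $X_i$ be the indicator variable of the event $p_i\in\Pi(P_i)$. Then: (A) If $|\Pi(X)|=k$ for all $X\subseteq P$ with $|X|\ge k$, and $|\Pi(X)|=|X|$ for all $X\subseteq P$ with $|X|<k$, then for any $\gamma\ge 2e$, $$\Pr\Big[\sum_{i} X_i>\gamma\cdot(2k\ln n)\Big]\le n^{-\gamma k}.$$ (B) The bound in (A) holds under the weaker condition that $|\Pi(X)|\le k$ for all $X\subseteq P$. (C) Let $c$ be an arbitrary constant, let $c'>1$ be a constant depending only on $c$, and let $k'=c'k$. If, with probability at least $1-n^{-c}$, the bound $|\Pi(P_i)|\le k'$ holds for all $i$, then for any $\gamma\ge 2e$, $$\Pr\Big[\sum_{i} X_i>\gamma\cdot(2c'k\ln n)\Big]\le n^{-\gamma k}+n^{-c}.$$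
   Context: A property $\Pi$ of a finite set $P$ is a function that maps every subset $X\subseteq P$ to a subset $\Pi(X)\subseteq X$. *)

theory Defs
  imports "HOL-Probability.Probability" "HOL-Combinatorics.Multiset_Permutations"
begin

text \<open>Properties are called \<open>\<Phi>\<close> because \<open>Pi\<close> is taken by library syntax for function spaces.\<close>

definition is_property :: "'a set \<Rightarrow> ('a set \<Rightarrow> 'a set) \<Rightarrow> bool" where
  "is_property P \<Phi> \<longleftrightarrow> finite P \<and> (\<forall>X\<subseteq>P. \<Phi> X \<subseteq> X)"

definition random_perm :: "'a set \<Rightarrow> 'a list pmf" where
  "random_perm P = pmf_of_set (permutations_of_set P)"

text \<open>
  A permutation \<open>p\<^sub>1, \<dots>, p\<^sub>n\<close> is a list without repetitions. Positions
  are counted from 1, so \<open>p\<^sub>i\<close> is the list entry with index \<open>i - 1\<close>; the definitions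
  below are meant for \<open>1 \<le> i \<le> n\<close> only.
\<close>

definition perm_elem :: "'a list \<Rightarrow> nat \<Rightarrow> 'a" where
  "perm_elem ps i = ps ! (i - 1)"

definition perm_prefix :: "'a list \<Rightarrow> nat \<Rightarrow> 'a set" where
  "perm_prefix ps i = perm_elem ps ` {1..i}"

definition X_ind :: "('a set \<Rightarrow> 'a set) \<Rightarrow> nat \<Rightarrow> 'a list \<Rightarrow> real" where
  "X_ind \<Phi> i = indicator {ps. perm_elem ps i \<in> \<Phi> (perm_prefix ps i)}"

end

theory Submission
  imports Defs
begin

text \<open>
  Removing the last element of a uniformly random permutation of \<open>P\<close> leaves a uniformly random
  permutation of the remaining set, and given \<open>P\<^sub>i\<close> the element \<open>p\<^sub>i\<close> is uniform in
  \<open>P\<^sub>i\<close>. Hence, if \<open>|\<Phi> X| \<le> K\<close> throughout, the moment generating function of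
  \<open>\<Sum>i. X\<^sub>i\<close> at \<open>1\<close> is at most \<open>\<Prod>i. (1 + K (e - 1) / i) \<le> exp (K (e - 1) H\<^sub>n)\<close>, and Chernoff's
  bound gives (B), of which (A) is a special case. For (C), truncate \<open>\<Phi>\<close> to be empty wherever its
  value has more than \<open>k'\<close> elements: the sum is unchanged on the good event.
\<close>

text \<open>The difference \<open>harm n - ln n\<close> is decreasing from n = 1 on, where it equals
  1.\<close>

lemma harm_le_ln_plus_1:
  assumes "n > 0"
  shows "harm n \<le> ln (real n) + 1"
proof -
  obtain m where n: "n = Suc m"
    using assms by (cases n) auto
  have "harm (Suc m) - ln (real (Suc m)) \<le> harm (Suc 0) - ln (real (Suc 0))"
    using decseq_harm_diff_ln by (rule decseqD) simp
  then show ?thesis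
    by (simp add: n harm_expand)
qed

text \<open>Reversal permutes the permutations of a set, so the library recursion on the head of the
  list becomes one on its last entry. The last entry is the right one to split off, since the
  prefixes before it are then untouched.\<close>

lemma sum_permutations_of_set_snoc:
  assumes "finite A" "A \<noteq> {}"
  shows "(\<Sum>ps\<in>permutations_of_set A. f ps) =
    (\<Sum>x\<in>A. \<Sum>qs\<in>permutations_of_set (A - {x}). f (qs @ [x]))"
proof -
  have rev: "(\<Sum>ps\<in>permutations_of_set B. g (rev ps)) = (\<Sum>ps\<in>permutations_of_set B. g ps)"
    for B :: "'a set" and g
    by (rule sum.reindex_bij_betw) (simp add: bij_betw_def inj_on_def)
  have "(\<Sum>ps\<in>permutations_of_set A. f ps) = (\<Sum>ps\<in>permutations_of_set A. f (rev ps))"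
    by (rule rev[symmetric])
  also have "\<dots> = (\<Sum>ps\<in>(\<Union>x\<in>A. (#) x ` permutations_of_set (A - {x})). f (rev ps))"
    using assms by (simp add: permutations_of_set_nonempty)
  also have "\<dots> = (\<Sum>x\<in>A. \<Sum>ps\<in>(#) x ` permutations_of_set (A - {x}). f (rev ps))"
    using assms by (intro sum.UNION_disjoint) auto
  also have "\<dots> = (\<Sum>x\<in>A. \<Sum>qs\<in>permutations_of_set (A - {x}). f (rev qs @ [x]))"
    by (simp add: sum.reindex)
  also have "\<dots> = (\<Sum>x\<in>A. \<Sum>qs\<in>permutations_of_set (A - {x}). f (qs @ [x]))"
    by (intro sum.cong refl rev)
  finally show ?thesis .
qed

text \<open>Position 0 is excluded: truncated subtraction makes it read list index 0, which belongs
  to \<open>rs\<close> when \<open>qs\<close> is empty.\<close>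

lemma perm_elem_append:
  "i \<in> {1..length qs} \<Longrightarrow> perm_elem (qs @ rs) i = perm_elem qs i"
  by (auto simp: perm_elem_def nth_append)

lemma perm_prefix_append:
  "i \<le> length qs \<Longrightarrow> perm_prefix (qs @ rs) i = perm_prefix qs i"
  unfolding perm_prefix_def by (intro image_cong refl perm_elem_append) auto

lemma perm_prefix_length: "perm_prefix ps (length ps) = set ps"
proof -
  have "perm_prefix ps (length ps) = (\<lambda>i. ps ! (i - 1)) ` Suc ` {..<length ps}"
    by (auto simp: perm_prefix_def perm_elem_def image_Suc_lessThan)
  then show ?thesis
    by (auto simp: image_image in_set_conv_nth)
qed

lemma X_ind_append:
  "i \<in> {1..length qs} \<Longrightarrow> X_ind \<Phi> i (qs @ rs) = X_ind \<Phi> i qs"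
  by (simp add: X_ind_def indicator_def perm_elem_append perm_prefix_append)

text \<open>The earlier indicators see only \<open>qs\<close>, and the last prefix is the whole set,
  so the new term depends on the order of \<open>qs\<close> in no way. This is what lets the
  exponential factor in the induction below.\<close>

lemma sum_X_ind_snoc:
  "(\<Sum>i=1..Suc (length qs). X_ind \<Phi> i (qs @ [x])) =
    (\<Sum>i=1..length qs. X_ind \<Phi> i qs) + indicator (\<Phi> (insert x (set qs))) x"
proof -
  have "X_ind \<Phi> (Suc (length qs)) (qs @ [x]) = indicator (\<Phi> (insert x (set qs))) x"
    using perm_prefix_length[of "qs @ [x]"]
    by (simp add: X_ind_def indicator_def perm_elem_def)
  moreover have "(\<Sum>i=1..length qs. X_ind \<Phi> i (qs @ [x])) = (\<Sum>i=1..length qs. X_ind \<Phi> i qs)"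
    by (intro sum.cong refl X_ind_append)
  ultimately show ?thesis
    by simp
qed

text \<open>This is the moment generating function bound multiplied by the number
  \<open>fact (card A)\<close> of permutations. The induction conditions on the last element x; the
  hypotheses pass to \<open>A - {x}\<close> because they speak of all subsets.\<close>

lemma sum_exp_X_ind_le:
  fixes K :: real
  assumes "finite A"
    and "\<And>X. X \<subseteq> A \<Longrightarrow> \<Phi> X \<subseteq> X" "\<And>X. X \<subseteq> A \<Longrightarrow> real (card (\<Phi> X)) \<le> K"
  shows "(\<Sum>ps\<in>permutations_of_set A. exp (\<Sum>i=1..card A. X_ind \<Phi> i ps))
    \<le> fact (card A) * exp (K * (exp 1 - 1) * harm (card A))"
  using assms
proof (induction "card A" arbitrary: A)
  case 0
  then show ?case
    by (simp add: harm_expand)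
next
  case (Suc m)
  define L where "L = fact m * exp (K * (exp 1 - 1) * harm m)"
  have "A \<noteq> {}"
    using Suc.hyps(2) by auto
  have card_diff: "card (A - {x}) = m" if "x \<in> A" for x
    using that Suc.hyps(2) Suc.prems(1) by simp
  have inner: "(\<Sum>qs\<in>permutations_of_set (A - {x}). exp (\<Sum>i=1..m. X_ind \<Phi> i qs)) \<le> L"
    if "x \<in> A" for x
  proof -
    have "\<Phi> X \<subseteq> X" "real (card (\<Phi> X)) \<le> K" if "X \<subseteq> A - {x}" for X
      using that Suc.prems(2,3)[of X] by auto
    then show ?thesis
      using Suc.hyps(1)[of "A - {x}"] Suc.prems(1) card_diff[OF that] by (simp add: L_def)
  qed
  have subset: "\<Phi> A \<subseteq> A"
    using Suc.prems(2) by simp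
  \<comment> \<open>On the values 0 and 1, \<open>exp t\<close> coincides with the affine function
    \<open>1 + (exp 1 - 1) * t\<close>, so the sum only depends on the size of
    \<open>\<Phi> A\<close>.\<close>
  have "(\<Sum>x\<in>A. exp (indicator (\<Phi> A) x :: real)) = (\<Sum>x\<in>A. 1 + (exp 1 - 1) * indicator (\<Phi> A) x)"
    by (intro sum.cong) (auto simp: indicator_def)
  also have "\<dots> = real (Suc m) + (exp 1 - 1) * card (\<Phi> A)"
    using Suc.prems(1) subset Suc.hyps(2)
    by (simp add: sum.distrib indicator_def sum.If_cases Int_absorb1 flip: sum_distrib_left)
  also have "\<dots> \<le> real (Suc m) + (exp 1 - 1) * K"
    using Suc.prems(3)[of A] by (intro add_left_mono mult_left_mono) auto
  also have "\<dots> = real (Suc m) * (1 + K * (exp 1 - 1) / real (Suc m))"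
    by (simp add: field_simps)
  \<comment> \<open>Passing from \<open>1 + t\<close> to \<open>exp t\<close> makes the exponents
    add up over the induction; their terms \<open>1 / Suc m\<close> build the harmonic
    number.\<close>
  also have "\<dots> \<le> real (Suc m) * exp (K * (exp 1 - 1) / real (Suc m))"
    by (intro mult_left_mono exp_ge_add_one_self) simp
  finally have step:
    "(\<Sum>x\<in>A. exp (indicator (\<Phi> A) x :: real)) \<le> real (Suc m) * exp (K * (exp 1 - 1) / real (Suc m))" .
  have "(\<Sum>ps\<in>permutations_of_set A. exp (\<Sum>i=1..Suc m. X_ind \<Phi> i ps)) =
      (\<Sum>x\<in>A. \<Sum>qs\<in>permutations_of_set (A - {x}). exp (\<Sum>i=1..Suc m. X_ind \<Phi> i (qs @ [x])))"
    using Suc.prems(1) \<open>A \<noteq> {}\<close> by (rule sum_permutations_of_set_snoc)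
  \<comment> \<open>Whatever x is, the full prefix is A, so the last indicator always refers to the
    same set \<open>\<Phi> A\<close>.\<close>
  also have "\<dots> = (\<Sum>x\<in>A. \<Sum>qs\<in>permutations_of_set (A - {x}).
      exp (indicator (\<Phi> A) x) * exp (\<Sum>i=1..m. X_ind \<Phi> i qs))"
  proof (intro sum.cong refl)
    fix x qs assume x: "x \<in> A" and qs: "qs \<in> permutations_of_set (A - {x})"
    have "length qs = m"
      using length_finite_permutations_of_set[OF qs] card_diff[OF x] by simp
    moreover have "insert x (set qs) = A"
      using qs x by (auto simp: permutations_of_set_def)
    ultimately show "exp (\<Sum>i=1..Suc m. X_ind \<Phi> i (qs @ [x])) =
        exp (indicator (\<Phi> A) x) * exp (\<Sum>i=1..m. X_ind \<Phi> i qs)"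
      using sum_X_ind_snoc[of \<Phi> qs x] by (simp add: exp_add)
  qed
  also have "\<dots> \<le> (\<Sum>x\<in>A. exp (indicator (\<Phi> A) x) * L)"
    unfolding sum_distrib_left[symmetric] by (intro sum_mono mult_left_mono inner) auto
  also have "\<dots> \<le> real (Suc m) * exp (K * (exp 1 - 1) / real (Suc m)) * L"
    unfolding sum_distrib_right[symmetric] by (rule mult_right_mono[OF step]) (simp add: L_def)
  also have "\<dots> = fact (Suc m) * exp (K * (exp 1 - 1) * harm (Suc m))"
    by (simp add: L_def harm_Suc distrib_left exp_add inverse_eq_divide del: of_nat_Suc)
  finally show ?case
    by (simp only: Suc.hyps(2)[symmetric])
qed

text \<open>Chernoff's bound with parameter 1. K is real because (C) uses it with
  \<open>c' * k\<close>, which may fail to be an integer.\<close>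

lemma prob_sum_X_ind_gt:
  fixes K \<gamma> :: real
  assumes "finite P" and "card P = n" and "real n \<ge> (exp 1)\<^sup>2"
    and "\<And>X. X \<subseteq> P \<Longrightarrow> \<Phi> X \<subseteq> X" "\<And>X. X \<subseteq> P \<Longrightarrow> real (card (\<Phi> X)) \<le> K"
    and "\<gamma> \<ge> 2 * exp 1"
  shows "measure_pmf.prob (random_perm P) {ps. (\<Sum>i=1..n. X_ind \<Phi> i ps) > \<gamma> * (2 * K * ln (real n))}
    \<le> real n powr (- (\<gamma> * K))"
proof -
  define S where "S = permutations_of_set P"
  define Y where "Y ps = (\<Sum>i=1..n. X_ind \<Phi> i ps)" for ps
  define a where "a = \<gamma> * (2 * K * ln (real n))"
  have S: "finite S" "S \<noteq> {}" "real (card S) = fact n"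
    using assms(1,2) by (auto simp: S_def)
  have "0 < (exp 1 :: real)\<^sup>2"
    by simp
  then have "real n > 0"
    using assms(3) by linarith
  have "ln ((exp 1)\<^sup>2) \<le> ln (real n)"
    using assms(3) \<open>real n > 0\<close> by (subst ln_le_cancel_iff) auto
  then have ln_ge: "2 \<le> ln (real n)"
    by (simp add: ln_realpow)
  have "0 \<le> K"
    using assms(5)[of "{}"] by simp
  have "measure_pmf.prob (random_perm P) {ps. Y ps > a} = card (S \<inter> {ps. Y ps > a}) / fact n"
    using S by (simp add: random_perm_def measure_pmf_of_set flip: S_def)
  also have "real (card (S \<inter> {ps. Y ps > a})) = (\<Sum>ps\<in>S \<inter> {ps. Y ps > a}. 1)"
    by simp
  \<comment> \<open>Markov's inequality in counting form: \<open>exp (Y ps - a)\<close> is at least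
    1 on the event and positive elsewhere.\<close>
  also have "\<dots> \<le> (\<Sum>ps\<in>S \<inter> {ps. Y ps > a}. exp (Y ps - a))"
    by (intro sum_mono) simp
  also have "\<dots> \<le> (\<Sum>ps\<in>S. exp (Y ps - a))"
    using S by (intro sum_mono2) auto
  also have "\<dots> = (\<Sum>ps\<in>S. exp (Y ps)) / exp a"
    by (simp add: exp_diff sum_divide_distrib)
  also have "\<dots> \<le> fact n * exp (K * (exp 1 - 1) * harm n) / exp a"
    using sum_exp_X_ind_le[of P \<Phi> K] assms by (intro divide_right_mono) (auto simp: S_def Y_def)
  finally have "measure_pmf.prob (random_perm P) {ps. Y ps > a} \<le> 
      fact n * exp (K * (exp 1 - 1) * harm n) / exp a / fact n"
    by (simp add: divide_right_mono)
  also have "\<dots> = exp (K * (exp 1 - 1) * harm n - a)"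
    by (simp add: exp_diff)
  also have "K * (exp 1 - 1) * harm n - a \<le> - (\<gamma> * K) * ln (real n)"
  proof -
    \<comment> \<open>From n \<ge> e^2 follows 1 \<le> ln n, hence harm n \<le> 2 ln n. As \<gamma>
      \<ge> 2e, the positive exponent is then at most half of \<open>a\<close>, and the other half
      gives the claimed power of n.\<close>
    have "(exp 1 - 1) * harm n \<le> exp 1 * (2 * ln (real n))"
      using harm_le_ln_plus_1[of n] \<open>real n > 0\<close> ln_ge harm_nonneg[of n]
      by (intro mult_mono) auto
    also have "\<dots> \<le> \<gamma> * ln (real n)"
      using mult_right_mono[OF assms(6), of "ln (real n)"] ln_ge by (simp add: mult_ac)
    finally have "K * ((exp 1 - 1) * harm n) \<le> K * (\<gamma> * ln (real n))"
      using \<open>0 \<le> K\<close> by (rule mult_left_mono)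
    then show ?thesis
      by (simp add: a_def algebra_simps)
  qed
  finally show ?thesis
    using \<open>real n > 0\<close> by (simp add: Y_def a_def powr_def)
qed

lemma prob_sum_X_ind_gt_truncated:
  fixes K \<gamma> \<delta> :: real
  assumes "finite P" and "card P = n" and "real n \<ge> (exp 1)\<^sup>2"
    and "\<And>X. X \<subseteq> P \<Longrightarrow> \<Phi> X \<subseteq> X" and "0 \<le> K"
    and good: "measure_pmf.prob (random_perm P)
      {ps. \<forall>i\<in>{1..n}. real (card (\<Phi> (perm_prefix ps i))) \<le> K} \<ge> 1 - \<delta>"
    and "\<gamma> \<ge> 2 * exp 1"
  shows "measure_pmf.prob (random_perm P) {ps. (\<Sum>i=1..n. X_ind \<Phi> i ps) > \<gamma> * (2 * K * ln (real n))}
    \<le> real n powr (- (\<gamma> * K)) + \<delta>"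
proof -
  \<comment> \<open>Where the value is cut to the empty set, its size 0 meets the bound thanks to
    \<open>0 \<le> K\<close>. Thus \<open>\<Psi>\<close> satisfies the uniform bound on all subsets
    of P, and it agrees with \<open>\<Phi>\<close> on every nonempty prefix of a permutation in
    \<open>G\<close>.\<close>
  define \<Psi> where "\<Psi> X = (if real (card (\<Phi> X)) \<le> K then \<Phi> X else {})" for X
  define a where "a = \<gamma> * (2 * K * ln (real n))"
  define G where "G = {ps. \<forall>i\<in>{1..n}. real (card (\<Phi> (perm_prefix ps i))) \<le> K}"
  let ?p = "measure_pmf.prob (random_perm P)"
  have "(\<Sum>i=1..n. X_ind \<Phi> i ps) = (\<Sum>i=1..n. X_ind \<Psi> i ps)" if "ps \<in> G" for ps
    using that by (intro sum.cong refl) (simp add: G_def X_ind_def \<Psi>_def indicator_def)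
  then have "{ps. (\<Sum>i=1..n. X_ind \<Phi> i ps) > a} \<subseteq> {ps. (\<Sum>i=1..n. X_ind \<Psi> i ps) > a} \<union> - G"
    by auto
  then have "?p {ps. (\<Sum>i=1..n. X_ind \<Phi> i ps) > a} \<le> ?p ({ps. (\<Sum>i=1..n. X_ind \<Psi> i ps) > a} \<union> - G)"
    by (intro measure_pmf.finite_measure_mono) auto
  also have "\<dots> \<le> ?p {ps. (\<Sum>i=1..n. X_ind \<Psi> i ps) > a} + ?p (- G)"
    by (intro measure_Un_le) auto
  also have "?p {ps. (\<Sum>i=1..n. X_ind \<Psi> i ps) > a} \<le> real n powr (- (\<gamma> * K))"
    unfolding a_def using assms by (intro prob_sum_X_ind_gt) (auto simp: \<Psi>_def)
  also have "?p (- G) \<le> \<delta>"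
    using good measure_pmf.prob_compl[of G "random_perm P"] by (simp add: G_def Compl_eq_Diff_UNIV)
  finally show ?thesis
    by (simp add: a_def)
qed

theorem lemma3p4:
  fixes P :: "'a set" and \<Phi> :: "'a set \<Rightarrow> 'a set" and n k :: nat
  assumes "finite P" and "card P = n" and "real n \<ge> (exp 1)\<^sup>2"
    and "k \<ge> 1"
    and "is_property P \<Phi>"
  shows
    "((\<forall>X\<subseteq>P. card X \<ge> k \<longrightarrow> card (\<Phi> X) = k) \<and>
      (\<forall>X\<subseteq>P. card X < k \<longrightarrow> card (\<Phi> X) = card X) \<longrightarrow>
      (\<forall>\<gamma>::real. \<gamma> \<ge> 2 * exp 1 \<longrightarrow>
        measure_pmf.prob (random_perm P)
          {ps. (\<Sum>i=1..n. X_ind \<Phi> i ps) > \<gamma> * (2 * real k * ln (real n))}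
        \<le> real n powr (- (\<gamma> * real k))))
     \<and>
     ((\<forall>X\<subseteq>P. card (\<Phi> X) \<le> k) \<longrightarrow>
      (\<forall>\<gamma>::real. \<gamma> \<ge> 2 * exp 1 \<longrightarrow>
        measure_pmf.prob (random_perm P)
          {ps. (\<Sum>i=1..n. X_ind \<Phi> i ps) > \<gamma> * (2 * real k * ln (real n))}
        \<le> real n powr (- (\<gamma> * real k))))
     \<and>
     (\<forall>(c::real) (c'::real) (k'::real).
      c' > 1 \<and> k' = c' * real k \<and>
      measure_pmf.prob (random_perm P)
        {ps. \<forall>i\<in>{1..n}. real (card (\<Phi> (perm_prefix ps i))) \<le> k'}
      \<ge> 1 - real n powr (- c) \<longrightarrow>
      (\<forall>\<gamma>::real. \<gamma> \<ge> 2 * exp 1 \<longrightarrow>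
        measure_pmf.prob (random_perm P)
          {ps. (\<Sum>i=1..n. X_ind \<Phi> i ps) > \<gamma> * (2 * c' * real k * ln (real n))}
        \<le> real n powr (- (\<gamma> * real k)) + real n powr (- c)))"
proof -
  have sub: "\<Phi> X \<subseteq> X" if "X \<subseteq> P" for X
    using assms(5) that by (simp add: is_property_def)
  have B: "measure_pmf.prob (random_perm P)
      {ps. (\<Sum>i=1..n. X_ind \<Phi> i ps) > \<gamma> * (2 * real k * ln (real n))} \<le> real n powr (- (\<gamma> * real k))"
    if "\<forall>X\<subseteq>P. card (\<Phi> X) \<le> k" "\<gamma> \<ge> 2 * exp 1" for \<gamma> :: real
    using assms(1-3) sub that by (intro prob_sum_X_ind_gt) auto
  \<comment> \<open>Under the hypotheses of (A) the size is the minimum of k and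
    \<open>card X\<close>, so (B) applies.\<close>
  have A: "\<forall>X\<subseteq>P. card (\<Phi> X) \<le> k"
    if "\<forall>X\<subseteq>P. card X \<ge> k \<longrightarrow> card (\<Phi> X) = k" "\<forall>X\<subseteq>P. card X < k \<longrightarrow> card (\<Phi> X) = card X"
    using that by (metis le_eq_less_or_eq linorder_not_less)
  have C: "measure_pmf.prob (random_perm P)
      {ps. (\<Sum>i=1..n. X_ind \<Phi> i ps) > \<gamma> * (2 * c' * real k * ln (real n))}
      \<le> real n powr (- (\<gamma> * real k)) + real n powr (- c)"
    if c': "c' > 1" and good: "measure_pmf.prob (random_perm P)
        {ps. \<forall>i\<in>{1..n}. real (card (\<Phi> (perm_prefix ps i))) \<le> c' * real k} \<ge> 1 - real n powr (- c)"
      and \<gamma>: "\<gamma> \<ge> 2 * exp 1" for c c' \<gamma> :: real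
  proof -
    have "1 \<le> (exp 1 :: real)\<^sup>2"
      by (rule one_le_power) simp
    then have "1 \<le> real n"
      using assms(3) by linarith
    have "0 \<le> \<gamma>"
      using \<gamma> exp_gt_zero[of "1::real"] by linarith
    have "measure_pmf.prob (random_perm P)
        {ps. (\<Sum>i=1..n. X_ind \<Phi> i ps) > \<gamma> * (2 * (c' * real k) * ln (real n))}
        \<le> real n powr (- (\<gamma> * (c' * real k))) + real n powr (- c)"
      using assms(1-3) sub c' good \<gamma> by (intro prob_sum_X_ind_gt_truncated) auto
    moreover have "real k \<le> c' * real k"
      using c' by (simp add: mult_le_cancel_right1)
    \<comment> \<open>Truncation at \<open>c' * k\<close> yields the stronger exponent with
      \<open>c' * k\<close>; since n \<ge> 1 and \<gamma> \<ge> 0, it may be weakened to the one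
      with k.\<close>
    then have "real n powr (- (\<gamma> * (c' * real k))) \<le> real n powr (- (\<gamma> * real k))"
      using \<open>1 \<le> real n\<close> \<open>0 \<le> \<gamma>\<close> by (intro powr_mono le_imp_neg_le mult_left_mono)
    ultimately show ?thesis
      by (simp add: mult.assoc)
  qed
  show ?thesis
    using A B C by blast
qed

end
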